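(* Let $G$ be a connected real Lie group with Lie algebra $\mathfrak{g}$. Suppose $G$ is also a complex manifold, whose complex structure $J$ is left-invariant, and $\mathfrak{g}^{\mathbb{C}}=\mathfrak{g}^{1,0}\oplus\mathfrak{g}^{0,1}$. Then there is a one-to-one correspondence between left-invariant complex Finsler metrics $\widetilde F:T^{1,0}G\to[0,+\infty)$ on $G$ and complex Minkowski norms $F:\mathfrak{g}^{1,0}\to[0,+\infty)$ on $\mathfrak{g}^{1,0}$.
   Context: The Lie algebra $\mathfrak{g}$ is identified with the left-invariant vector fields on $G$, equivalently with $T_eG$, where $e$ is the identity element. The left-invariant complex structure $J$ induces a real endomorphism $I$ of $\mathfrak{g}$ with $I^2=-\mathrm{Id}$; $\mathfrak{g}^{\mathbb{C}}=\mathfrak{g}\otimes_{\mathbb{R}}\mathbb{C}$, and $\mathfrak{g}^{1,0}$, $\mathfrak{g}^{0,1}$ are the $+\sqrt{-1}$ and $-\sqrt{-1}$ eigenspaces of the complex-linear extension of $I$ to $\mathfrak{g}^{\mathbb{C}}$. A complex Minkowski norm on a finite-dimensional complex vector space $V$ is a continuous function $F:V\to[0,+\infty)$ that is smooth on $V\setminus\{0\}$ and satisfies $F(\lambda v)=|\lambda|F(v)$ for all $v\in V$, $\lambda\in\mathbb{C}$. A complex Finsler metric on a complex manifold $M$ is a continuous function $F:T^{1,0}M\to[0,+\infty)$ whose restriction to each fiber $T^{1,0}_zM$ is a complex Minkowski norm. A complex Finsler metric $\widetilde F$ on $G$ is left-invariant if $\widetilde F((L_g)_*v)=\widetilde F(v)$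 for all $g\in G$, $v\in T^{1,0}G$, where $L_g$ is left translation by $g$. *)

theory Defs
  imports "HOL-Analysis.Analysis" "HOL-Library.Function_Algebras" "HOL-Algebra.Group"
begin

section \<open>Smooth and holomorphic maps between open subsets of vector spaces\<close>

(* Only meant for open S: the derivatives are taken in the ambient space. *)
primrec times_differentiable_on ::
    "nat \<Rightarrow> 'v::real_normed_vector set \<Rightarrow> ('v \<Rightarrow> 'w::real_normed_vector) \<Rightarrow> bool" where
  "times_differentiable_on 0 S f \<longleftrightarrow> continuous_on S f"
| "times_differentiable_on (Suc k) S f \<longleftrightarrow>
     (\<forall>x\<in>S. f differentiable (at x)) \<and>
     (\<forall>v. times_differentiable_on k S (\<lambda>x. frechet_derivative f (at x) v))"

definition smooth_on :: "'v::real_normed_vector set \<Rightarrow> ('v \<Rightarrow> 'w::real_normed_vector) \<Rightarrow> bool" where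
  "smooth_on S f \<longleftrightarrow> (\<forall>k. times_differentiable_on k S f)"

definition holomorphic_map_on :: "(complex ^ 'n) set \<Rightarrow> (complex ^ 'n \<Rightarrow> complex ^ 'n) \<Rightarrow> bool" where
  "holomorphic_map_on S f \<longleftrightarrow>
     (\<forall>x\<in>S. \<exists>D. (f has_derivative D) (at x) \<and> Vector_Spaces.linear (*s) (*s) D)"

section \<open>Manifolds\<close>

(* A chart is a pair of its domain and its coordinate map; the values of the
   coordinate map outside the domain are irrelevant. *)
type_synonym ('a, 'e) chart = "'a set \<times> ('a \<Rightarrow> 'e)"

abbreviation chart_inv :: "('a, 'e) chart \<Rightarrow> 'e \<Rightarrow> 'a" where
  "chart_inv c \<equiv> inv_into (fst c) (snd c)"

definition is_chart :: "'a topology \<Rightarrow> ('a, 'e::euclidean_space) chart \<Rightarrow> bool" where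
  "is_chart X c \<longleftrightarrow>
     openin X (fst c) \<and> open (snd c ` fst c) \<and>
     homeomorphic_map (subtopology X (fst c)) (top_of_set (snd c ` fst c)) (snd c)"

definition second_countable_space :: "'a topology \<Rightarrow> bool" where
  "second_countable_space X \<longleftrightarrow>
     (\<exists>\<B>. countable \<B> \<and> (\<forall>V\<in>\<B>. openin X V) \<and>
          (\<forall>U x. openin X U \<and> x \<in> U \<longrightarrow> (\<exists>V\<in>\<B>. x \<in> V \<and> V \<subseteq> U)))"

definition topological_manifold_atlas :: "'a topology \<Rightarrow> ('a, 'e::euclidean_space) chart set \<Rightarrow> bool" where
  "topological_manifold_atlas X A \<longleftrightarrow>
     Hausdorff_space X \<and> second_countable_space X \<and>
     (\<forall>c\<in>A. is_chart X c) \<and> topspace X = (\<Union>c\<in>A. fst c)"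

(* Atlases are not required to be maximal. *)
definition smooth_manifold :: "'a topology \<Rightarrow> ('a, 'e::euclidean_space) chart set \<Rightarrow> bool" where
  "smooth_manifold X A \<longleftrightarrow>
     topological_manifold_atlas X A \<and>
     (\<forall>c\<in>A. \<forall>d\<in>A. smooth_on (snd c ` (fst c \<inter> fst d)) (snd d \<circ> chart_inv c))"

definition complex_manifold :: "'a topology \<Rightarrow> ('a, complex ^ 'n) chart set \<Rightarrow> bool" where
  "complex_manifold X Z \<longleftrightarrow>
     topological_manifold_atlas X Z \<and>
     (\<forall>c\<in>Z. \<forall>d\<in>Z. holomorphic_map_on (snd c ` (fst c \<inter> fst d)) (snd d \<circ> chart_inv c))"

definition smooth_map ::
    "'a topology \<Rightarrow> ('a, 'e::euclidean_space) chart set \<Rightarrow>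
     'b topology \<Rightarrow> ('b, 'f::euclidean_space) chart set \<Rightarrow> ('a \<Rightarrow> 'b) \<Rightarrow> bool" where
  "smooth_map X A Y B f \<longleftrightarrow>
     continuous_map X Y f \<and>
     (\<forall>c\<in>A. \<forall>d\<in>B. smooth_on (snd c ` {p \<in> fst c. f p \<in> fst d}) (snd d \<circ> f \<circ> chart_inv c))"

definition product_atlas :: "('a, 'e) chart set \<Rightarrow> ('b, 'f) chart set \<Rightarrow> ('a \<times> 'b, 'e \<times> 'f) chart set" where
  "product_atlas A B = {(fst c \<times> fst d, map_prod (snd c) (snd d)) | c d. c \<in> A \<and> d \<in> B}"

section \<open>Tangent spaces and differentials\<close>

(* A tangent vector at p assigns to every chart around p its coordinate vector in
   that chart, subject to the usual transformation law.  The value 0 at all other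
   charts makes the tangent space a subspace of the space of all families. *)
type_synonym ('a, 'e) tangent = "('a, 'e) chart \<Rightarrow> 'e"

instantiation "fun" :: (type, real_vector) real_vector
begin

definition "scaleR r f = (\<lambda>x. r *\<^sub>R f x)"

instance
  by standard (auto simp: scaleR_fun_def fun_eq_iff algebra_simps)

end

definition charts_at :: "('a, 'e) chart set \<Rightarrow> 'a \<Rightarrow> ('a, 'e) chart set" where
  "charts_at A p = {c \<in> A. p \<in> fst c}"

definition tangent_space :: "('a, 'e::euclidean_space) chart set \<Rightarrow> 'a \<Rightarrow> ('a, 'e) tangent set" where
  "tangent_space A p =
     {\<xi>. (\<forall>c. c \<notin> charts_at A p \<longrightarrow> \<xi> c = 0) \<and>
         (\<forall>c\<in>charts_at A p. \<forall>d\<in>charts_at A p.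
            \<xi> d = frechet_derivative (snd d \<circ> chart_inv c) (at (snd c p)) (\<xi> c))}"

(* By the transformation law the result does not depend on the chosen chart c. *)
definition differential ::
    "('a, 'e::euclidean_space) chart set \<Rightarrow> ('b, 'f::euclidean_space) chart set \<Rightarrow>
     ('a \<Rightarrow> 'b) \<Rightarrow> 'a \<Rightarrow> ('a, 'e) tangent \<Rightarrow> ('b, 'f) tangent" where
  "differential A B f p \<xi> =
     (let c = (SOME c. c \<in> charts_at A p) in
      (\<lambda>d. if d \<in> charts_at B (f p)
           then frechet_derivative (snd d \<circ> f \<circ> chart_inv c) (at (snd c p)) (\<xi> c) else 0))"

section \<open>Complexification\<close>

(* The complexification of a real vector space V is V \<times> V, where (u, v) stands for
   u \<otimes> 1 + v \<otimes> \<i>. *)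
definition cscale :: "complex \<Rightarrow> 'v::real_vector \<times> 'v \<Rightarrow> 'v \<times> 'v" where
  "cscale z w = (Re z *\<^sub>R fst w - Im z *\<^sub>R snd w, Re z *\<^sub>R snd w + Im z *\<^sub>R fst w)"

definition complexification :: "'v set \<Rightarrow> ('v \<times> 'v) set" where
  "complexification V = V \<times> V"

definition complexified_map :: "('v \<Rightarrow> 'w) \<Rightarrow> 'v \<times> 'v \<Rightarrow> 'w \<times> 'w" where
  "complexified_map T = map_prod T T"

definition eigenspace_10 :: "'v::real_vector set \<Rightarrow> ('v \<Rightarrow> 'v) \<Rightarrow> ('v \<times> 'v) set" where
  "eigenspace_10 V T = {w \<in> complexification V. complexified_map T w = cscale \<i> w}"

definition eigenspace_01 :: "'v::real_vector set \<Rightarrow> ('v \<Rightarrow> 'v) \<Rightarrow> ('v \<times> 'v) set" where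
  "eigenspace_01 V T = {w \<in> complexification V. complexified_map T w = cscale (- \<i>) w}"

definition is_direct_sum :: "'w::ab_group_add set \<Rightarrow> 'w set \<Rightarrow> 'w set \<Rightarrow> bool" where
  "is_direct_sum W U V \<longleftrightarrow> W = {u + v | u v. u \<in> U \<and> v \<in> V} \<and> U \<inter> V = {0}"

section \<open>The complex structure and the holomorphic tangent bundle\<close>

(* The complex charts belong to the smooth structure given by A. *)
definition compatible_atlases ::
    "'a topology \<Rightarrow> ('a, 'e::euclidean_space) chart set \<Rightarrow> ('a, complex ^ 'n) chart set \<Rightarrow> bool" where
  "compatible_atlases X A Z \<longleftrightarrow> smooth_map X A X Z (\<lambda>x. x) \<and> smooth_map X Z X A (\<lambda>x. x)"

(* J acts on T_pM as multiplication by \<i> in holomorphic coordinates; the differential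
   of the identity from A to Z expresses tangent vectors in the complex charts. *)
definition complex_structure ::
    "('a, 'e::euclidean_space) chart set \<Rightarrow> ('a, complex ^ 'n) chart set \<Rightarrow>
     'a \<Rightarrow> ('a, 'e) tangent \<Rightarrow> ('a, 'e) tangent" where
  "complex_structure A Z p \<xi> =
     (THE \<eta>. \<eta> \<in> tangent_space A p \<and>
        differential A Z (\<lambda>x. x) p \<eta> = (\<lambda>z. \<i> *s differential A Z (\<lambda>x. x) p \<xi> z))"

definition holomorphic_tangent_space ::
    "('a, 'e::euclidean_space) chart set \<Rightarrow> ('a, complex ^ 'n) chart set \<Rightarrow> 'a \<Rightarrow>
     (('a, 'e) tangent \<times> ('a, 'e) tangent) set" where
  "holomorphic_tangent_space A Z p = eigenspace_10 (tangent_space A p) (complex_structure A Z p)"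

definition complexified_tangent_bundle ::
    "'a topology \<Rightarrow> ('a, 'e::euclidean_space) chart set \<Rightarrow>
     ('a \<times> ('a, 'e) tangent \<times> ('a, 'e) tangent) set" where
  "complexified_tangent_bundle X A = (SIGMA p : topspace X. complexification (tangent_space A p))"

(* The topology for which the bundle charts (p, \<xi>, \<eta>) \<mapsto> (c p, \<xi> c, \<eta> c), c \<in> A, are
   homeomorphisms onto open sets. *)
definition complexified_tangent_topology ::
    "'a topology \<Rightarrow> ('a, 'e::euclidean_space) chart set \<Rightarrow>
     ('a \<times> ('a, 'e) tangent \<times> ('a, 'e) tangent) topology" where
  "complexified_tangent_topology X A = topology_generated_by
     {{(p, \<xi>, \<eta>) \<in> complexified_tangent_bundle X A. p \<in> fst c \<and> (snd c p, \<xi> c, \<eta> c) \<in> W} | c W.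
        c \<in> A \<and> open W}"

definition holomorphic_tangent_bundle ::
    "'a topology \<Rightarrow> ('a, 'e::euclidean_space) chart set \<Rightarrow> ('a, complex ^ 'n) chart set \<Rightarrow>
     ('a \<times> ('a, 'e) tangent \<times> ('a, 'e) tangent) set" where
  "holomorphic_tangent_bundle X A Z = (SIGMA p : topspace X. holomorphic_tangent_space A Z p)"

definition holomorphic_tangent_topology ::
    "'a topology \<Rightarrow> ('a, 'e::euclidean_space) chart set \<Rightarrow> ('a, complex ^ 'n) chart set \<Rightarrow>
     ('a \<times> ('a, 'e) tangent \<times> ('a, 'e) tangent) topology" where
  "holomorphic_tangent_topology X A Z =
     subtopology (complexified_tangent_topology X A) (holomorphic_tangent_bundle X A Z)"

section \<open>Complex Minkowski norms and complex Finsler metrics\<close>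

(* V is a complex vector space of dimension CARD('n), given as a subspace of an ambient
   space with scalar multiplication smul.  Its topology and smooth structure are those
   transported by a linear isomorphism L from complex ^ 'n onto V; they do not depend on L.
   Functions on V are represented as extensional functions. *)
definition complex_minkowski_norm ::
    "'n::finite itself \<Rightarrow> (complex \<Rightarrow> 'w::ab_group_add \<Rightarrow> 'w) \<Rightarrow> 'w set \<Rightarrow> ('w \<Rightarrow> real) \<Rightarrow> bool" where
  "complex_minkowski_norm _ smul V F \<longleftrightarrow>
     F \<in> V \<rightarrow>\<^sub>E {0..} \<and>
     (\<exists>L :: complex ^ 'n \<Rightarrow> 'w.
        Vector_Spaces.linear (*s) smul L \<and> bij_betw L UNIV V \<and>
        continuous_on UNIV (F \<circ> L) \<and> smooth_on (UNIV - {0}) (F \<circ> L)) \<and>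
     (\<forall>a. \<forall>v\<in>V. F (smul a v) = cmod a * F v)"

definition complex_finsler_metric ::
    "'a topology \<Rightarrow> ('a, 'e::euclidean_space) chart set \<Rightarrow> ('a, complex ^ 'n) chart set \<Rightarrow>
     ('a \<times> ('a, 'e) tangent \<times> ('a, 'e) tangent \<Rightarrow> real) \<Rightarrow> bool" where
  "complex_finsler_metric X A Z F \<longleftrightarrow>
     F \<in> holomorphic_tangent_bundle X A Z \<rightarrow>\<^sub>E {0..} \<and>
     continuous_map (holomorphic_tangent_topology X A Z) euclideanreal F \<and>
     (\<forall>p\<in>topspace X.
        complex_minkowski_norm TYPE('n) cscale (holomorphic_tangent_space A Z p)
          (\<lambda>w\<in>holomorphic_tangent_space A Z p. F (p, w)))"

section \<open>Lie groups and left-invariance\<close>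

definition lie_group ::
    "'a topology \<Rightarrow> ('a, 'e::euclidean_space) chart set \<Rightarrow> ('a, 'm) monoid_scheme \<Rightarrow> bool" where
  "lie_group X A G \<longleftrightarrow>
     group G \<and> carrier G = topspace X \<and> smooth_manifold X A \<and>
     smooth_map (prod_topology X X) (product_atlas A A) X A (\<lambda>(x, y). x \<otimes>\<^bsub>G\<^esub> y) \<and>
     smooth_map X A X A (\<lambda>x. inv\<^bsub>G\<^esub> x)"

definition left_translation :: "('a, 'm) monoid_scheme \<Rightarrow> 'a \<Rightarrow> 'a \<Rightarrow> 'a" where
  "left_translation G g = (\<lambda>x. g \<otimes>\<^bsub>G\<^esub> x)"

definition left_invariant_complex_structure ::
    "('a, 'e::euclidean_space) chart set \<Rightarrow> ('a, complex ^ 'n) chart set \<Rightarrow> ('a, 'm) monoid_scheme \<Rightarrow> bool" where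
  "left_invariant_complex_structure A Z G \<longleftrightarrow>
     (\<forall>g\<in>carrier G. \<forall>p\<in>carrier G. \<forall>\<xi>\<in>tangent_space A p.
        differential A A (left_translation G g) p (complex_structure A Z p \<xi>) =
        complex_structure A Z (g \<otimes>\<^bsub>G\<^esub> p) (differential A A (left_translation G g) p \<xi>))"

definition left_pushforward ::
    "('a, 'e::euclidean_space) chart set \<Rightarrow> ('a, 'm) monoid_scheme \<Rightarrow> 'a \<Rightarrow>
     'a \<times> ('a, 'e) tangent \<times> ('a, 'e) tangent \<Rightarrow> 'a \<times> ('a, 'e) tangent \<times> ('a, 'e) tangent" where
  "left_pushforward A G g =
     (\<lambda>(p, w). (g \<otimes>\<^bsub>G\<^esub> p, complexified_map (differential A A (left_translation G g) p) w))"

definition left_invariant_metric ::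
    "'a topology \<Rightarrow> ('a, 'e::euclidean_space) chart set \<Rightarrow> ('a, complex ^ 'n) chart set \<Rightarrow>
     ('a, 'm) monoid_scheme \<Rightarrow> ('a \<times> ('a, 'e) tangent \<times> ('a, 'e) tangent \<Rightarrow> real) \<Rightarrow> bool" where
  "left_invariant_metric X A Z G F \<longleftrightarrow>
     (\<forall>g\<in>carrier G. \<forall>v\<in>holomorphic_tangent_bundle X A Z. F (left_pushforward A G g v) = F v)"

(* Under the usual identification of left-invariant vector fields with their values at the
   identity; only the vector space structure is used. *)
definition lie_algebra ::
    "('a, 'e::euclidean_space) chart set \<Rightarrow> ('a, 'm) monoid_scheme \<Rightarrow> ('a, 'e) tangent set" where
  "lie_algebra A G = tangent_space A \<one>\<^bsub>G\<^esub>"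

definition lie_algebra_10 ::
    "('a, 'e::euclidean_space) chart set \<Rightarrow> ('a, complex ^ 'n) chart set \<Rightarrow> ('a, 'm) monoid_scheme \<Rightarrow>
     (('a, 'e) tangent \<times> ('a, 'e) tangent) set" where
  "lie_algebra_10 A Z G = eigenspace_10 (lie_algebra A G) (complex_structure A Z \<one>\<^bsub>G\<^esub>)"

definition lie_algebra_01 ::
    "('a, 'e::euclidean_space) chart set \<Rightarrow> ('a, complex ^ 'n) chart set \<Rightarrow> ('a, 'm) monoid_scheme \<Rightarrow>
     (('a, 'e) tangent \<times> ('a, 'e) tangent) set" where
  "lie_algebra_01 A Z G = eigenspace_01 (lie_algebra A G) (complex_structure A Z \<one>\<^bsub>G\<^esub>)"

end

theory Submission
  imports Defs
begin

text \<open>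
  The inverse of restriction to the identity sends a norm \<open>F\<close> to
  \<open>F' (p, w) = F (dL\<^bsub>p\<inverse>\<^esub> w)\<close>.  Since \<open>J\<close> commutes with the differentials of left translations,
  these map the spaces \<open>T\<^sup>1\<^sup>,\<^sup>0\<close> isomorphically onto each other, and by the chain rule \<open>F'\<close> is
  left-invariant and the only left-invariant extension of \<open>F\<close>.  For the continuity of \<open>F'\<close>, note that
  in charts \<open>dL\<^bsub>p\<inverse>\<^esub>\<close> is the partial derivative of the multiplication in its second argument at
  \<open>(p\<inverse>, p)\<close>, which depends continuously on \<open>p\<close>, and that \<open>F\<close> is the restriction of a continuous
  function of chart coordinates, because a linear parametrisation of \<open>\<gg>\<^sup>1\<^sup>,\<^sup>0\<close> followed by coordinates
  has a linear left inverse.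
\<close>

section \<open>Charts\<close>

lemma chart_inj_on:
  assumes "is_chart X c"
  shows "inj_on (snd c) (fst c)"
proof -
  \<comment> \<open>\<open>homeomorphic_map\<close> speaks of the points of the subtopology; these
    are all of \<open>fst c\<close> because chart domains are open in \<open>X\<close>.\<close>
  have "fst c \<subseteq> topspace X"
    using assms by (auto simp: is_chart_def dest: openin_subset)
  then have "topspace (subtopology X (fst c)) = fst c"
    by auto
  then show ?thesis
    using assms homeomorphic_imp_injective_map unfolding is_chart_def by fastforce
qed

lemma chart_inv_image:
  assumes "is_chart X c" "p \<in> fst c"
  shows "chart_inv c (snd c p) = p"
  using chart_inj_on[OF assms(1)] assms(2) by simp

lemma open_chart_image:
  assumes "is_chart X c" "openin X U" "U \<subseteq> fst c"
  shows "open (snd c ` U)"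
proof -
  have "open_map (subtopology X (fst c)) (top_of_set (snd c ` fst c)) (snd c)"
    using assms(1) by (auto simp: is_chart_def intro: homeomorphic_imp_open_map)
  moreover have "openin (subtopology X (fst c)) U"
    using assms(2,3) by (auto simp: openin_subtopology)
  ultimately have "openin (top_of_set (snd c ` fst c)) (snd c ` U)"
    by (auto simp: open_map_def)
  then show ?thesis
    using assms(1) openin_open_trans unfolding is_chart_def by blast
qed

lemma openin_continuous_preimage_chart:
  assumes "is_chart X c" "is_chart Y d" "continuous_map X Y f"
  shows "openin X {q \<in> fst c. f q \<in> fst d}"
proof -
  have c: "openin X (fst c)" and d: "openin Y (fst d)"
    using assms by (auto simp: is_chart_def)
  have "{q \<in> fst c. f q \<in> fst d} = fst c \<inter> {q \<in> topspace X. f q \<in> fst d}"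
    using openin_subset[OF c] by auto
  then show ?thesis
    using c openin_continuous_map_preimage[OF assms(3) d] by auto
qed

section \<open>Smoothness and the chain rule in charts\<close>

lemma smooth_on_imp_differentiable:
  assumes "smooth_on S f" "x \<in> S"
  shows "f differentiable (at x)"
  using assms times_differentiable_on.simps(2) unfolding smooth_on_def by blast

lemma smooth_on_imp_continuous_on:
  assumes "smooth_on S f"
  shows "continuous_on S f"
  using assms times_differentiable_on.simps(1) unfolding smooth_on_def by blast

lemma smooth_on_imp_continuous_on_derivative:
  assumes "smooth_on S f"
  shows "continuous_on S (\<lambda>x. frechet_derivative f (at x) v)"
  using assms times_differentiable_on.simps unfolding smooth_on_def by metis

text \<open>Continuity of \<open>f\<close> makes the set of points of \<open>fst c\<close> that
  \<open>f\<close> sends into \<open>fst d\<close> open. On its coordinates,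
  \<open>h \<circ> f \<circ> chart_inv c\<close> agrees with the composite through \<open>d\<close>,
  so the derivatives agree. The outer map \<open>h\<close> is left arbitrary: a chart gives the
  transformation law, and a chart after a further map gives independence of charts and
  functoriality.\<close>

lemma chart_chain_rule:
  assumes c: "is_chart X c" "p \<in> fst c"
    and d: "is_chart Y d" "f p \<in> fst d"
    and f: "continuous_map X Y f"
    and df: "(snd d \<circ> f \<circ> chart_inv c) differentiable (at (snd c p))"
    and dh: "(h \<circ> chart_inv d) differentiable (at (snd d (f p)))"
  shows "((h \<circ> f \<circ> chart_inv c) has_derivative
           (frechet_derivative (h \<circ> chart_inv d) (at (snd d (f p))) \<circ>
            frechet_derivative (snd d \<circ> f \<circ> chart_inv c) (at (snd c p)))) (at (snd c p))"
proof -
  define S where "S = snd c ` {q \<in> fst c. f q \<in> fst d}"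
  have S: "open S" "snd c p \<in> S"
    using open_chart_image[OF c(1) openin_continuous_preimage_chart[OF c(1) d(1) f]] c d
    by (auto simp: S_def)
  have "(snd d \<circ> f \<circ> chart_inv c) (snd c p) = snd d (f p)"
    using chart_inv_image[OF c] by simp
  then have "((h \<circ> chart_inv d) \<circ> (snd d \<circ> f \<circ> chart_inv c) has_derivative
           (frechet_derivative (h \<circ> chart_inv d) (at (snd d (f p))) \<circ>
            frechet_derivative (snd d \<circ> f \<circ> chart_inv c) (at (snd c p)))) (at (snd c p))"
    using df dh by (intro diff_chain_at) (simp_all add: frechet_derivative_works)
  then show ?thesis
    by (rule has_derivative_transform_within_open[OF _ S])
      (auto simp: S_def chart_inv_image[OF c(1)] chart_inv_image[OF d(1)])
qed

lemmas frechet_derivative_chart_chain =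
  chart_chain_rule[THEN frechet_derivative_at, symmetric]

section \<open>Differentials\<close>

text \<open>A pointwise first-order condition, weaker than \<open>smooth_map\<close>, since a
  differential at \<open>p\<close> uses only first derivatives there. Continuity of \<open>f\<close>
  is not included and is assumed separately.\<close>

definition differentiable_map_at ::
    "('a, 'e::euclidean_space) chart set \<Rightarrow> ('b, 'f::euclidean_space) chart set \<Rightarrow>
     ('a \<Rightarrow> 'b) \<Rightarrow> 'a \<Rightarrow> bool" where
  "differentiable_map_at A B f p \<longleftrightarrow>
     (\<forall>c\<in>charts_at A p. \<forall>d\<in>charts_at B (f p).
        (snd d \<circ> f \<circ> chart_inv c) differentiable (at (snd c p)))"

lemma smooth_manifold_is_chart:
  assumes "smooth_manifold X A" "c \<in> charts_at A p"
  shows "is_chart X c" "p \<in> fst c"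
  using assms by (auto simp: smooth_manifold_def topological_manifold_atlas_def charts_at_def)

lemma smooth_manifold_charts_at:
  assumes "smooth_manifold X A" "p \<in> topspace X"
  shows "charts_at A p \<noteq> {}"
  using assms by (auto simp: smooth_manifold_def topological_manifold_atlas_def charts_at_def)

lemma transition_differentiable:
  assumes "smooth_manifold X A" "c \<in> charts_at A p" "d \<in> charts_at A p"
  shows "(snd d \<circ> chart_inv c) differentiable (at (snd c p))"
  using assms unfolding smooth_manifold_def charts_at_def
  by (intro smooth_on_imp_differentiable[of "snd c ` (fst c \<inter> fst d)"]) auto

lemma tangent_space_transition:
  assumes "\<xi> \<in> tangent_space A p" "c \<in> charts_at A p" "d \<in> charts_at A p"
  shows "\<xi> d = frechet_derivative (snd d \<circ> chart_inv c) (at (snd c p)) (\<xi> c)"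
  using assms unfolding tangent_space_def by blast

lemma tangent_space_outside:
  assumes "\<xi> \<in> tangent_space A p" "c \<notin> charts_at A p"
  shows "\<xi> c = 0"
  using assms unfolding tangent_space_def by blast

text \<open>The transformation law computes every coordinate from one of them, and outside
  \<open>charts_at A p\<close> all tangent vectors vanish.\<close>

lemma tangent_space_eqI:
  assumes "\<xi> \<in> tangent_space A p" "\<eta> \<in> tangent_space A p" "c \<in> charts_at A p" "\<xi> c = \<eta> c"
  shows "\<xi> = \<eta>"
proof
  fix d
  show "\<xi> d = \<eta> d"
  proof (cases "d \<in> charts_at A p")
    case True
    then show ?thesis
      using tangent_space_transition[OF assms(1,3)] tangent_space_transition[OF assms(2,3)] assms(4)
      by metis
  next
    case False
    then show ?thesis
      using assms(1,2) by (simp add: tangent_space_outside)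
  qed
qed

section \<open>The differential of one map at one point\<close>

context
  fixes X :: "'a topology" and A :: "('a, 'e::euclidean_space) chart set"
    and Y :: "'b topology" and B :: "('b, 'f::euclidean_space) chart set"
    and f :: "'a \<Rightarrow> 'b" and p :: 'a
  assumes XA: "smooth_manifold X A" and YB: "smooth_manifold Y B"
    and f: "continuous_map X Y f" and p: "p \<in> topspace X"
    and df: "differentiable_map_at A B f p"
begin

text \<open>The definition evaluates in a chosen chart \<open>c0\<close>. The chain rule with the
  identity as inner map exchanges \<open>c0\<close> for \<open>c\<close>, and the transformation law
  of \<open>\<xi>\<close> absorbs the transition map.\<close>

lemma differential_in_chart:
  assumes \<xi>: "\<xi> \<in> tangent_space A p" and c: "c \<in> charts_at A p" and d: "d \<in> charts_at B (f p)"
  shows "differential A B f p \<xi> d =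
           frechet_derivative (snd d \<circ> f \<circ> chart_inv c) (at (snd c p)) (\<xi> c)"
proof -
  define c0 where "c0 = (SOME c. c \<in> charts_at A p)"
  have c0: "c0 \<in> charts_at A p"
    unfolding c0_def using c by (rule someI)
  note cc = smooth_manifold_is_chart[OF XA c] and cc0 = smooth_manifold_is_chart[OF XA c0]
  have df0: "(snd d \<circ> f \<circ> chart_inv c0) differentiable (at (snd c0 p))"
    using df c0 d by (auto simp: differentiable_map_at_def)
  have "frechet_derivative (snd d \<circ> f \<circ> id \<circ> chart_inv c) (at (snd c p)) =
        frechet_derivative (snd d \<circ> f \<circ> chart_inv c0) (at (snd c0 (id p))) \<circ>
        frechet_derivative (snd c0 \<circ> id \<circ> chart_inv c) (at (snd c p))"
    using cc cc0 df0 transition_differentiable[OF XA c c0]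
    by (intro frechet_derivative_chart_chain[where X = X and Y = X]) auto
  then show ?thesis
    using tangent_space_transition[OF \<xi> c c0] d by (simp add: differential_def flip: c0_def)
qed

lemma differential_in_tangent_space:
  assumes \<xi>: "\<xi> \<in> tangent_space A p"
  shows "differential A B f p \<xi> \<in> tangent_space B (f p)"
proof -
  obtain c where c: "c \<in> charts_at A p"
    using smooth_manifold_charts_at[OF XA p] by auto
  note cc = smooth_manifold_is_chart[OF XA c]
  have "differential A B f p \<xi> d' =
      frechet_derivative (snd d' \<circ> chart_inv d) (at (snd d (f p))) (differential A B f p \<xi> d)"
    if d: "d \<in> charts_at B (f p)" and d': "d' \<in> charts_at B (f p)" for d d'
  proof -
    note dd = smooth_manifold_is_chart[OF YB d]
    \<comment> \<open>With \<open>d'\<close> as outer map, the chain rule is the transformation law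
      from \<open>d\<close> to \<open>d'\<close>.\<close>
    have "frechet_derivative (snd d' \<circ> f \<circ> chart_inv c) (at (snd c p)) =
        frechet_derivative (snd d' \<circ> chart_inv d) (at (snd d (f p))) \<circ>
        frechet_derivative (snd d \<circ> f \<circ> chart_inv c) (at (snd c p))"
      using cc dd f transition_differentiable[OF YB d d'] df c d
      by (intro frechet_derivative_chart_chain[where X = X and Y = Y])
        (auto simp: differentiable_map_at_def)
    then show ?thesis
      using differential_in_chart[OF \<xi> c] d d' by simp
  qed
  moreover have "differential A B f p \<xi> d = 0" if "d \<notin> charts_at B (f p)" for d
    using that by (simp add: differential_def Let_def)
  ultimately have "(\<forall>d. d \<notin> charts_at B (f p) \<longrightarrow> differential A B f p \<xi> d = 0) \<and>
      (\<forall>d\<in>charts_at B (f p). \<forall>d'\<in>charts_at B (f p). differential A B f p \<xi> d' =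
        frechet_derivative (snd d' \<circ> chart_inv d) (at (snd d (f p))) (differential A B f p \<xi> d))"
    by (intro conjI allI ballI impI)
  then show ?thesis
    by (simp only: tangent_space_def mem_Collect_eq)
qed

text \<open>Both sides are computed in one chosen chart, where the derivative is linear. Hence
  linearity holds for arbitrary families and not only for tangent vectors, which makes the
  complexified map linear on the whole ambient space.\<close>

lemma differential_lincomb:
  "differential A B f p (\<lambda>c. r *\<^sub>R \<xi> c + s *\<^sub>R \<eta> c) =
     (\<lambda>d. r *\<^sub>R differential A B f p \<xi> d + s *\<^sub>R differential A B f p \<eta> d)"
proof
  fix d
  define c0 where "c0 = (SOME c. c \<in> charts_at A p)"
  have c0: "c0 \<in> charts_at A p"
    unfolding c0_def using smooth_manifold_charts_at[OF XA p] by (simp add: some_in_eq)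
  show "differential A B f p (\<lambda>c. r *\<^sub>R \<xi> c + s *\<^sub>R \<eta> c) d =
     r *\<^sub>R differential A B f p \<xi> d + s *\<^sub>R differential A B f p \<eta> d"
  proof (cases "d \<in> charts_at B (f p)")
    case True
    then have "linear (frechet_derivative (snd d \<circ> f \<circ> chart_inv c0) (at (snd c0 p)))"
      using df c0 by (intro linear_frechet_derivative) (auto simp: differentiable_map_at_def)
    then show ?thesis
      using True by (simp add: differential_def linear_add linear_scale flip: c0_def)
  qed (simp add: differential_def Let_def)
qed

text \<open>The complexification of a real linear map is complex linear: both components of a
  complex multiple are real linear combinations of \<open>u\<close> and \<open>v\<close>.\<close>

lemma complexified_differential_cscale:
  "complexified_map (differential A B f p) (cscale z w) =
     cscale z (complexified_map (differential A B f p) w)"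
proof -
  obtain u v where w: "w = (u, v)" by (cases w)
  have "differential A B f p (Re z *\<^sub>R u - Im z *\<^sub>R v) =
      Re z *\<^sub>R differential A B f p u - Im z *\<^sub>R differential A B f p v"
    using differential_lincomb[of "Re z" u "- Im z" v]
    by (simp add: fun_diff_def scaleR_fun_def)
  moreover have "differential A B f p (Re z *\<^sub>R v + Im z *\<^sub>R u) =
      Re z *\<^sub>R differential A B f p v + Im z *\<^sub>R differential A B f p u"
    using differential_lincomb[of "Re z" v "Im z" u]
    by (simp add: plus_fun_def scaleR_fun_def)
  ultimately show ?thesis
    by (simp add: w complexified_map_def cscale_def)
qed

lemma complexified_differential_add:
  "complexified_map (differential A B f p) (w + w') =
     complexified_map (differential A B f p) w + complexified_map (differential A B f p) w'"
proof -
  have "differential A B f p (\<xi> + \<eta>) = differential A B f p \<xi> + differential A B f p \<eta>" for \<xi> \<eta>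
    using differential_lincomb[of 1 \<xi> 1 \<eta>] by (simp add: plus_fun_def)
  then show ?thesis
    by (cases w; cases w') (simp add: complexified_map_def)
qed

text \<open>A complex linear map that intertwines two endomorphisms carries eigenvectors to
  eigenvectors with the same eigenvalue. For left translations and the complex structure this gives
  the action on the bundle of type (1,0).\<close>

lemma eigenspace_10_complexified_differential:
  assumes w: "w \<in> eigenspace_10 (tangent_space A p) J"
    and J: "\<And>\<xi>. \<xi> \<in> tangent_space A p \<Longrightarrow>
      differential A B f p (J \<xi>) = J' (differential A B f p \<xi>)"
  shows "complexified_map (differential A B f p) w \<in> eigenspace_10 (tangent_space B (f p)) J'"
proof -
  have w': "fst w \<in> tangent_space A p" "snd w \<in> tangent_space A p"
    and Jw: "complexified_map J w = cscale \<i> w"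
    using w by (auto simp: eigenspace_10_def complexification_def)
  have "complexified_map J' (complexified_map (differential A B f p) w) =
      complexified_map (differential A B f p) (complexified_map J w)"
    using w' J by (cases w) (simp add: complexified_map_def)
  also have "\<dots> = cscale \<i> (complexified_map (differential A B f p) w)"
    by (simp only: Jw complexified_differential_cscale)
  finally show ?thesis
    using w' differential_in_tangent_space
    by (simp add: eigenspace_10_def complexification_def complexified_map_def mem_Times_iff)
qed

end

section \<open>Functoriality and locality of the differential\<close>

lemma differential_compose:
  assumes XA: "smooth_manifold X A" and YB: "smooth_manifold Y B"
    and f: "continuous_map X Y f" and p: "p \<in> topspace X"
    and df: "differentiable_map_at A B f p" and dg: "differentiable_map_at B C g (f p)"
    and \<xi>: "\<xi> \<in> tangent_space A p"
  shows "differential B C g (f p) (differential A B f p \<xi>) = differential A C (g \<circ> f) p \<xi>"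
proof
  fix e
  \<comment> \<open>These are the charts chosen inside the differentials, so unfolding the
    definitions leaves derivatives in just these charts.\<close>
  define c d where "c = (SOME c. c \<in> charts_at A p)" and "d = (SOME d. d \<in> charts_at B (f p))"
  have "f p \<in> topspace Y"
    using f p by (auto simp: continuous_map_def)
  then have c: "c \<in> charts_at A p" and d: "d \<in> charts_at B (f p)"
    unfolding c_def d_def
    using smooth_manifold_charts_at[OF XA p] smooth_manifold_charts_at[OF YB]
    by (simp_all add: some_in_eq)
  note cc = smooth_manifold_is_chart[OF XA c] and dd = smooth_manifold_is_chart[OF YB d]
  show "differential B C g (f p) (differential A B f p \<xi>) e = differential A C (g \<circ> f) p \<xi> e"
  proof (cases "e \<in> charts_at C (g (f p))")
    case True
    have "frechet_derivative ((snd e \<circ> g) \<circ> f \<circ> chart_inv c) (at (snd c p)) =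
        frechet_derivative ((snd e \<circ> g) \<circ> chart_inv d) (at (snd d (f p))) \<circ>
        frechet_derivative (snd d \<circ> f \<circ> chart_inv c) (at (snd c p))"
      using cc dd f df dg c d True
      by (intro frechet_derivative_chart_chain[where X = X and Y = Y])
        (auto simp: differentiable_map_at_def)
    then show ?thesis
      using True differential_in_chart[OF XA YB f p df \<xi> c d]
      by (simp add: differential_def[of B C] differential_def[of A C] comp_assoc flip: c_def d_def)
  qed (simp add: differential_def Let_def)
qed

text \<open>Derivatives are local and chart domains are open in \<open>X\<close>, so values off
  \<open>topspace X\<close> have no influence. The group laws hold only on the carrier, which is why
  the maps are compared only there.\<close>

lemma differential_cong:
  fixes B :: "('b, 'f::euclidean_space) chart set"
  assumes XA: "smooth_manifold X A" and p: "p \<in> topspace X"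
    and eq: "\<And>x. x \<in> topspace X \<Longrightarrow> f x = g x"
  shows "differential A B f p = differential A B g p"
proof -
  define c where "c = (SOME c. c \<in> charts_at A p)"
  have "c \<in> charts_at A p"
    unfolding c_def using smooth_manifold_charts_at[OF XA p] by (simp add: some_in_eq)
  note c = smooth_manifold_is_chart[OF XA this]
  have sub: "fst c \<subseteq> topspace X" and op: "open (snd c ` fst c)"
    using c(1) by (auto simp: is_chart_def dest: openin_subset)
  have "((h \<circ> f \<circ> chart_inv c) has_derivative D) (at (snd c p)) \<longleftrightarrow>
        ((h \<circ> g \<circ> chart_inv c) has_derivative D) (at (snd c p))" for h :: "'b \<Rightarrow> 'f" and D
    using op c(2) sub eq chart_inv_image[OF c(1)]
    by (intro iffI; elim has_derivative_transform_within_open[OF _ op]) auto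
  then have "frechet_derivative (h \<circ> f \<circ> chart_inv c) (at (snd c p)) =
        frechet_derivative (h \<circ> g \<circ> chart_inv c) (at (snd c p))" for h :: "'b \<Rightarrow> 'f"
    by (simp add: frechet_derivative_def)
  then show ?thesis
    by (simp add: differential_def fun_eq_iff eq p flip: c_def)
qed

lemma differential_ident:
  assumes XA: "smooth_manifold X A" and p: "p \<in> topspace X" and \<xi>: "\<xi> \<in> tangent_space A p"
  shows "differential A A (\<lambda>x. x) p \<xi> = \<xi>"
proof
  fix d
  define c where "c = (SOME c. c \<in> charts_at A p)"
  have c: "c \<in> charts_at A p"
    unfolding c_def using smooth_manifold_charts_at[OF XA p] by (simp add: some_in_eq)
  show "differential A A (\<lambda>x. x) p \<xi> d = \<xi> d"
  proof (cases "d \<in> charts_at A p")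
    case True
    then show ?thesis
      using tangent_space_transition[OF \<xi> c True]
      by (simp add: differential_def o_def flip: c_def)
  next
    case False
    then show ?thesis
      using \<xi> by (simp add: differential_def Let_def tangent_space_outside)
  qed
qed

section \<open>Left translations\<close>

lemma lie_groupD:
  assumes "lie_group X A G"
  shows "group G" "carrier G = topspace X" "smooth_manifold X A"
  using assms by (auto simp: lie_group_def)

lemma continuous_map_left_translation:
  assumes G: "lie_group X A G" and g: "g \<in> carrier G"
  shows "continuous_map X X (left_translation G g)"
proof -
  have "continuous_map (prod_topology X X) X (\<lambda>(x, y). x \<otimes>\<^bsub>G\<^esub> y)"
    using G by (simp add: lie_group_def smooth_map_def)
  moreover have "continuous_map X (prod_topology X X) (\<lambda>x. (g, x))"
    using g lie_groupD[OF G] by (intro continuous_map_pairedI) auto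
  ultimately have "continuous_map X X ((\<lambda>(x, y). x \<otimes>\<^bsub>G\<^esub> y) \<circ> (\<lambda>x. (g, x)))"
    by (rule continuous_map_compose[rotated])
  then show ?thesis
    by (simp add: left_translation_def o_def)
qed

section \<open>Multiplication in coordinates\<close>

definition product_chart :: "('a, 'e) chart \<Rightarrow> ('b, 'f) chart \<Rightarrow> ('a \<times> 'b, 'e \<times> 'f) chart" where
  "product_chart c d = (fst c \<times> fst d, map_prod (snd c) (snd d))"

text \<open>Reading the multiplication in charts of both factors makes the differential of a left
  translation a partial derivative, with the dependence on the translating element visible.\<close>

definition local_mult ::
    "('a, 'm) monoid_scheme \<Rightarrow> ('a, 'e) chart \<Rightarrow> ('a, 'e) chart \<Rightarrow> ('a, 'e) chart \<Rightarrow> 'e \<times> 'e \<Rightarrow> 'e" where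
  "local_mult G b c d = snd d \<circ> (\<lambda>(x, y). x \<otimes>\<^bsub>G\<^esub> y) \<circ> chart_inv (product_chart b c)"

lemma local_mult_image:
  assumes "is_chart X b" "is_chart X c" "x \<in> fst b" "y \<in> fst c"
  shows "local_mult G b c d (snd b x, snd c y) = snd d (x \<otimes>\<^bsub>G\<^esub> y)"
proof -
  have "inj_on (map_prod (snd b) (snd c)) (fst b \<times> fst c)"
    by (intro map_prod_inj_on chart_inj_on[OF assms(1)] chart_inj_on[OF assms(2)])
  then have "chart_inv (product_chart b c) (map_prod (snd b) (snd c) (x, y)) = (x, y)"
    unfolding product_chart_def fst_conv snd_conv using assms by (intro inv_into_f_f) auto
  then show ?thesis
    by (simp add: local_mult_def)
qed

lemma smooth_on_local_mult:
  assumes "lie_group X A G" "b \<in> A" "c \<in> A" "d \<in> A"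
  shows "smooth_on ((\<lambda>(x, y). (snd b x, snd c y)) `
           {(x, y). x \<in> fst b \<and> y \<in> fst c \<and> x \<otimes>\<^bsub>G\<^esub> y \<in> fst d}) (local_mult G b c d)"
proof -
  have "product_chart b c \<in> product_atlas A A"
    using assms unfolding product_atlas_def product_chart_def by blast
  then have "smooth_on (snd (product_chart b c) `
      {q \<in> fst (product_chart b c). (\<lambda>(x, y). x \<otimes>\<^bsub>G\<^esub> y) q \<in> fst d}) (local_mult G b c d)"
    using assms unfolding lie_group_def smooth_map_def local_mult_def by blast
  moreover have "snd (product_chart b c) `
      {q \<in> fst (product_chart b c). (\<lambda>(x, y). x \<otimes>\<^bsub>G\<^esub> y) q \<in> fst d} =
      (\<lambda>(x, y). (snd b x, snd c y)) `
           {(x, y). x \<in> fst b \<and> y \<in> fst c \<and> x \<otimes>\<^bsub>G\<^esub> y \<in> fst d}"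
    by (auto simp: product_chart_def image_iff)
  ultimately show ?thesis
    by simp
qed

lemma local_mult_differentiable:
  assumes "lie_group X A G" "b \<in> charts_at A g" "c \<in> charts_at A p" "d \<in> charts_at A (g \<otimes>\<^bsub>G\<^esub> p)"
  shows "local_mult G b c d differentiable (at (snd b g, snd c p))"
  using assms by (intro smooth_on_imp_differentiable[OF smooth_on_local_mult]) (auto simp: charts_at_def)

lemma left_translation_has_derivative:
  assumes G: "lie_group X A G" and g: "g \<in> carrier G"
    and b: "b \<in> charts_at A g" and c: "c \<in> charts_at A p" and d: "d \<in> charts_at A (g \<otimes>\<^bsub>G\<^esub> p)"
  shows "((snd d \<circ> left_translation G g \<circ> chart_inv c) has_derivative
           (\<lambda>v. frechet_derivative (local_mult G b c d) (at (snd b g, snd c p)) (0, v))) (at (snd c p))"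
proof -
  note XA = lie_groupD(3)[OF G]
  note bb = smooth_manifold_is_chart[OF XA b] and cc = smooth_manifold_is_chart[OF XA c]
  have "((\<lambda>y. (snd b g, y)) has_derivative (\<lambda>v. (0, v))) (at (snd c p))"
    by (auto intro!: derivative_eq_intros)
  moreover have "(local_mult G b c d has_derivative
      frechet_derivative (local_mult G b c d) (at (snd b g, snd c p))) (at (snd b g, snd c p))"
    using local_mult_differentiable[OF G b c d] by (simp add: frechet_derivative_works)
  ultimately have "(local_mult G b c d \<circ> (\<lambda>y. (snd b g, y)) has_derivative
     frechet_derivative (local_mult G b c d) (at (snd b g, snd c p)) \<circ> (\<lambda>v. (0, v))) (at (snd c p))"
    by (rule diff_chain_at)
  then have "((snd d \<circ> left_translation G g \<circ> chart_inv c) has_derivative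
     frechet_derivative (local_mult G b c d) (at (snd b g, snd c p)) \<circ> (\<lambda>v. (0, v))) (at (snd c p))"
    by (rule has_derivative_transform_within_open[of _ _ _ _ "snd c ` fst c"])
      (use bb cc in \<open>auto simp: is_chart_def chart_inv_image[OF cc(1)] left_translation_def
         local_mult_image[OF bb(1) cc(1)]\<close>)
  then show ?thesis
    by (simp add: o_def)
qed

lemma differentiable_left_translation:
  assumes G: "lie_group X A G" and g: "g \<in> carrier G"
  shows "differentiable_map_at A A (left_translation G g) p"
proof -
  obtain b where "b \<in> charts_at A g"
    using smooth_manifold_charts_at[OF lie_groupD(3)[OF G]] g lie_groupD(2)[OF G] by blast
  then show ?thesis
    using left_translation_has_derivative[OF G g]
    unfolding differentiable_map_at_def differentiable_def left_translation_def by blast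
qed

lemma differential_left_translation:
  assumes G: "lie_group X A G" and g: "g \<in> carrier G" and p: "p \<in> carrier G"
    and \<xi>: "\<xi> \<in> tangent_space A p"
    and b: "b \<in> charts_at A g" and c: "c \<in> charts_at A p" and d: "d \<in> charts_at A (g \<otimes>\<^bsub>G\<^esub> p)"
  shows "differential A A (left_translation G g) p \<xi> d =
           frechet_derivative (local_mult G b c d) (at (snd b g, snd c p)) (0, \<xi> c)"
proof -
  have "differential A A (left_translation G g) p \<xi> d =
      frechet_derivative (snd d \<circ> left_translation G g \<circ> chart_inv c) (at (snd c p)) (\<xi> c)"
    using lie_groupD[OF G] continuous_map_left_translation[OF G g] p
      differentiable_left_translation[OF G g] \<xi> c d
    by (intro differential_in_chart[where X = X and Y = X]) (auto simp: left_translation_def)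
  then show ?thesis
    using frechet_derivative_at[OF left_translation_has_derivative[OF G g b c d]] by metis
qed

section \<open>Left differentials on complexified tangent spaces\<close>

abbreviation left_differential ::
    "('a, 'e::euclidean_space) chart set \<Rightarrow> ('a, 'm) monoid_scheme \<Rightarrow> 'a \<Rightarrow> 'a \<Rightarrow>
     ('a, 'e) tangent \<times> ('a, 'e) tangent \<Rightarrow> ('a, 'e) tangent \<times> ('a, 'e) tangent" where
  "left_differential A G g p \<equiv> complexified_map (differential A A (left_translation G g) p)"

lemma holomorphic_tangent_space_subset:
  "holomorphic_tangent_space A Z p \<subseteq> tangent_space A p \<times> tangent_space A p"
  by (auto simp: holomorphic_tangent_space_def eigenspace_10_def complexification_def)

context
  fixes X :: "'a topology" and A :: "('a, 'e::euclidean_space) chart set"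
    and G :: "('a, 'm) monoid_scheme"
  assumes G: "lie_group X A G"
begin

lemma left_differential_cscale:
  assumes g: "g \<in> carrier G" and p: "p \<in> carrier G"
  shows "left_differential A G g p (cscale z w) = cscale z (left_differential A G g p w)"
  using complexified_differential_cscale[OF lie_groupD(3)[OF G] lie_groupD(3)[OF G]
      continuous_map_left_translation[OF G g] _ differentiable_left_translation[OF G g]]
    p lie_groupD(2)[OF G] by blast

lemma left_differential_add:
  assumes g: "g \<in> carrier G" and p: "p \<in> carrier G"
  shows "left_differential A G g p (w + w') = left_differential A G g p w + left_differential A G g p w'"
  using complexified_differential_add[OF lie_groupD(3)[OF G] lie_groupD(3)[OF G]
      continuous_map_left_translation[OF G g] _ differentiable_left_translation[OF G g]]
    p lie_groupD(2)[OF G] by blast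

text \<open>Left-invariance of the complex structure says that the differential intertwines the
  endomorphisms at \<open>p\<close> and at the translated point; hence it respects their
  eigenspaces. All further uses of this hypothesis pass through this lemma.\<close>

lemma left_differential_holomorphic:
  assumes J: "left_invariant_complex_structure A Z G"
    and g: "g \<in> carrier G" and p: "p \<in> carrier G" and w: "w \<in> holomorphic_tangent_space A Z p"
  shows "left_differential A G g p w \<in> holomorphic_tangent_space A Z (g \<otimes>\<^bsub>G\<^esub> p)"
proof -
  note XA = lie_groupD(3)[OF G]
  have "p \<in> topspace X"
    using p lie_groupD(2)[OF G] by simp
  moreover have "differential A A (left_translation G g) p (complex_structure A Z p \<xi>) =
      complex_structure A Z (g \<otimes>\<^bsub>G\<^esub> p) (differential A A (left_translation G g) p \<xi>)"
    if "\<xi> \<in> tangent_space A p" for \<xi>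
    using J g p that unfolding left_invariant_complex_structure_def by blast
  ultimately have "left_differential A G g p w \<in>
      eigenspace_10 (tangent_space A (left_translation G g p)) (complex_structure A Z (g \<otimes>\<^bsub>G\<^esub> p))"
    by (rule eigenspace_10_complexified_differential[OF XA XA continuous_map_left_translation[OF G g]
          _ differentiable_left_translation[OF G g] w[unfolded holomorphic_tangent_space_def]])
  then show ?thesis
    by (simp add: holomorphic_tangent_space_def left_translation_def)
qed

lemma left_differential_compose:
  assumes g: "g \<in> carrier G" and h: "h \<in> carrier G" and p: "p \<in> carrier G"
    and w: "w \<in> tangent_space A p \<times> tangent_space A p"
  shows "left_differential A G h (g \<otimes>\<^bsub>G\<^esub> p) (left_differential A G g p w) =
           left_differential A G (h \<otimes>\<^bsub>G\<^esub> g) p w"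
proof -
  interpret group G using lie_groupD[OF G] by simp
  note XA = lie_groupD(3)[OF G]
  have pX: "p \<in> topspace X"
    using p lie_groupD(2)[OF G] by simp
  have eq: "left_translation G g p = g \<otimes>\<^bsub>G\<^esub> p"
    by (simp add: left_translation_def)
  note comp = differential_compose[OF XA XA continuous_map_left_translation[OF G g] pX
      differentiable_left_translation[OF G g] differentiable_left_translation[OF G h],
      unfolded eq]
  have "left_differential A G h (g \<otimes>\<^bsub>G\<^esub> p) (left_differential A G g p w) =
      complexified_map (differential A A (left_translation G h \<circ> left_translation G g) p) w"
    using comp w by (cases w) (simp add: complexified_map_def)
  \<comment> \<open>Associativity identifies the composite of the two translations with the
    translation by the product, but only on \<open>topspace X\<close>.\<close>
  also have "\<dots> = left_differential A G (h \<otimes>\<^bsub>G\<^esub> g) p w"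
    using differential_cong[where f = "left_translation G h \<circ> left_translation G g"
        and g = "left_translation G (h \<otimes>\<^bsub>G\<^esub> g)" and B = A, OF XA pX] g h lie_groupD(2)[OF G]
    by (simp add: left_translation_def m_assoc)
  finally show ?thesis .
qed

lemma left_differential_one:
  assumes p: "p \<in> carrier G" and w: "w \<in> tangent_space A p \<times> tangent_space A p"
  shows "left_differential A G \<one>\<^bsub>G\<^esub> p w = w"
proof -
  interpret group G using lie_groupD[OF G] by simp
  note XA = lie_groupD(3)[OF G]
  have pX: "p \<in> topspace X"
    using p lie_groupD(2)[OF G] by simp
  have "differential A A (left_translation G \<one>\<^bsub>G\<^esub>) p \<xi> = \<xi>" if "\<xi> \<in> tangent_space A p" for \<xi>
    using differential_cong[where f = "left_translation G \<one>\<^bsub>G\<^esub>" and g = "\<lambda>x. x" and B = A, OF XA pX]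
      differential_ident[OF XA pX that] lie_groupD(2)[OF G]
    by (simp add: left_translation_def)
  then show ?thesis
    using w by (cases w) (simp add: complexified_map_def)
qed

text \<open>The composition rule applies to the products of \<open>p\<close> and its inverse in
  either order; both are the unit, whose left differential is the identity.\<close>

lemma left_differential_inverse:
  assumes p: "p \<in> carrier G"
  shows "w \<in> tangent_space A \<one>\<^bsub>G\<^esub> \<times> tangent_space A \<one>\<^bsub>G\<^esub> \<Longrightarrow>
           left_differential A G (inv\<^bsub>G\<^esub> p) p (left_differential A G p \<one>\<^bsub>G\<^esub> w) = w"
    and "w \<in> tangent_space A p \<times> tangent_space A p \<Longrightarrow>
           left_differential A G p \<one>\<^bsub>G\<^esub> (left_differential A G (inv\<^bsub>G\<^esub> p) p w) = w"
proof -
  interpret group G using lie_groupD[OF G] by simp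
  show "left_differential A G (inv\<^bsub>G\<^esub> p) p (left_differential A G p \<one>\<^bsub>G\<^esub> w) = w"
    if "w \<in> tangent_space A \<one>\<^bsub>G\<^esub> \<times> tangent_space A \<one>\<^bsub>G\<^esub>"
    using left_differential_compose[of p "inv\<^bsub>G\<^esub> p" "\<one>\<^bsub>G\<^esub>" w] left_differential_one[of "\<one>\<^bsub>G\<^esub>" w] that p
    by simp
  show "left_differential A G p \<one>\<^bsub>G\<^esub> (left_differential A G (inv\<^bsub>G\<^esub> p) p w) = w"
    if "w \<in> tangent_space A p \<times> tangent_space A p"
    using left_differential_compose[of "inv\<^bsub>G\<^esub> p" p p w] left_differential_one[of p w] that p
    by simp
qed

lemma left_differential_inv_holomorphic:
  assumes "left_invariant_complex_structure A Z G" "p \<in> carrier G" "w \<in> holomorphic_tangent_space A Z p"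
  shows "left_differential A G (inv\<^bsub>G\<^esub> p) p w \<in> holomorphic_tangent_space A Z \<one>\<^bsub>G\<^esub>"
proof -
  interpret group G using lie_groupD[OF G] by simp
  show ?thesis
    using left_differential_holomorphic[OF assms(1), of "inv\<^bsub>G\<^esub> p" p w] assms by simp
qed

lemma bij_betw_left_differential:
  assumes J: "left_invariant_complex_structure A Z G" and p: "p \<in> carrier G"
  shows "bij_betw (left_differential A G p \<one>\<^bsub>G\<^esub>)
           (holomorphic_tangent_space A Z \<one>\<^bsub>G\<^esub>) (holomorphic_tangent_space A Z p)"
proof -
  interpret group G using lie_groupD[OF G] by simp
  show ?thesis
  proof (rule bij_betw_byWitness[where f' = "left_differential A G (inv\<^bsub>G\<^esub> p) p"])
    show "left_differential A G p \<one>\<^bsub>G\<^esub> ` holomorphic_tangent_space A Z \<one>\<^bsub>G\<^esub> \<subseteq> holomorphic_tangent_space A Z p"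
      using left_differential_holomorphic[OF J p one_closed] p by auto
    show "left_differential A G (inv\<^bsub>G\<^esub> p) p ` holomorphic_tangent_space A Z p \<subseteq> holomorphic_tangent_space A Z \<one>\<^bsub>G\<^esub>"
      using left_differential_inv_holomorphic[OF J p] by auto
  qed (intro ballI, rule left_differential_inverse[OF p],
      erule subsetD[OF holomorphic_tangent_space_subset])+
qed

end

section \<open>Complex Minkowski norms\<close>

text \<open>If \<open>L\<close> parametrises \<open>V\<close>, then \<open>T \<circ> L\<close>
  parametrises \<open>V'\<close>, and \<open>F' \<circ> (T \<circ> L) = F \<circ> L\<close>.
  Continuity and smoothness are therefore literally the same conditions for both norms.\<close>

lemma complex_minkowski_norm_transport:
  fixes smul :: "complex \<Rightarrow> 'w::ab_group_add \<Rightarrow> 'w"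
  assumes F: "complex_minkowski_norm TYPE('n::finite) smul V F"
    and T: "bij_betw T V V'"
    and T_add: "\<And>x y. T (x + y) = T x + T y" and T_smul: "\<And>a x. T (smul a x) = smul a (T x)"
    and F'_T: "\<And>v. v \<in> V \<Longrightarrow> F' (T v) = F v" and F'_ext: "F' \<in> V' \<rightarrow>\<^sub>E {0..}"
  shows "complex_minkowski_norm TYPE('n) smul V' F'"
proof -
  obtain L :: "complex ^ 'n \<Rightarrow> 'w" where L: "Vector_Spaces.linear (*s) smul L" "bij_betw L UNIV V"
    "continuous_on UNIV (F \<circ> L)" "smooth_on (UNIV - {0}) (F \<circ> L)"
    using F by (auto simp: complex_minkowski_norm_def)
  interpret L: Vector_Spaces.linear "(*s)" smul L by (fact L(1))
  have LV: "L x \<in> V" for x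
    using L(2) by (auto simp: bij_betw_def)
  have comp: "F' \<circ> (T \<circ> L) = F \<circ> L"
    using F'_T LV by auto
  have "Vector_Spaces.linear (*s) smul (T \<circ> L)"
    by unfold_locales (simp_all add: L.add L.scale T_add T_smul)
  moreover have "bij_betw (T \<circ> L) UNIV V'"
    using L(2) T by (rule bij_betw_trans)
  moreover have "F' (smul a v) = cmod a * F' v" if v: "v \<in> V'" for a v
  proof -
    obtain x where x: "v = T (L x)"
      using v T L(2) by (auto simp: bij_betw_def)
    have "F' (smul a v) = F' (T (L (a *s x)))"
      by (simp add: x L.scale T_smul)
    also have "\<dots> = F (smul a (L x))"
      unfolding F'_T[OF LV] by (simp add: L.scale)
    also have "\<dots> = cmod a * F' v"
      using F LV by (simp add: x F'_T[OF LV] complex_minkowski_norm_def)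
    finally show ?thesis .
  qed
  ultimately show ?thesis
    using F'_ext L(3,4) unfolding complex_minkowski_norm_def comp[symmetric] by blast
qed

text \<open>The parametrisation \<open>L\<close> followed by coordinates in \<open>d\<close> is an
  injective real linear map \<open>\<Phi>\<close>. With a linear left inverse \<open>\<Psi>\<close>,
  the function \<open>F \<circ> L \<circ> \<Psi>\<close> extends \<open>F\<close> to all pairs of
  coordinates. This matches the bundle topology, which is given by such coordinates.\<close>

lemma complex_minkowski_norm_in_chart:
  fixes F :: "('a, 'e::euclidean_space) tangent \<times> ('a, 'e) tangent \<Rightarrow> real"
  assumes F: "complex_minkowski_norm TYPE('n::finite) cscale V F"
    and V: "V \<subseteq> tangent_space A p \<times> tangent_space A p" and d: "d \<in> charts_at A p"
  obtains H :: "'e \<times> 'e \<Rightarrow> real"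
    where "continuous_on UNIV H" "\<And>w. w \<in> V \<Longrightarrow> F w = H (fst w d, snd w d)"
proof -
  obtain L :: "complex ^ 'n \<Rightarrow> ('a, 'e) tangent \<times> ('a, 'e) tangent"
    where L: "Vector_Spaces.linear (*s) cscale L" "bij_betw L UNIV V" "continuous_on UNIV (F \<circ> L)"
    using F by (auto simp: complex_minkowski_norm_def)
  interpret L: Vector_Spaces.linear "(*s)" cscale L by (fact L(1))
  define \<Phi> where "\<Phi> = (\<lambda>x. (fst (L x) d, snd (L x) d))"
  have "linear \<Phi>"
  proof
    show "\<Phi> (x + y) = \<Phi> x + \<Phi> y" for x y
      by (simp add: \<Phi>_def L.add)
    show "\<Phi> (r *\<^sub>R x) = r *\<^sub>R \<Phi> x" for r x
    proof -
      \<comment> \<open>Real scaling is complex scaling by a real number, so complex linearity of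
        \<open>L\<close> gives real linearity of \<open>\<Phi>\<close>.\<close>
      have "r *\<^sub>R x = complex_of_real r *s x"
        by (simp add: vec_eq_iff) (simp add: scaleR_conv_of_real)
      then show ?thesis
        by (simp add: \<Phi>_def L.scale cscale_def scaleR_fun_def)
    qed
  qed
  moreover have "inj \<Phi>"
  proof (rule injI)
    fix x y assume "\<Phi> x = \<Phi> y"
    moreover have "L x \<in> V" "L y \<in> V"
      using L(2) by (auto simp: bij_betw_def)
    \<comment> \<open>One chart determines a tangent vector, so equal coordinates in
      \<open>d\<close> force equal components.\<close>
    ultimately have "L x = L y"
      using V d unfolding \<Phi>_def by (intro prod_eqI; intro tangent_space_eqI[of _ A p _ d]) auto
    then show "x = y"
      using L(2) by (auto simp: bij_betw_def inj_on_def)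
  qed
  ultimately obtain \<Psi> where \<Psi>: "linear \<Psi>" "\<Psi> \<circ> \<Phi> = id"
    using linear_injective_left_inverse by blast
  show thesis
  proof
    show "continuous_on UNIV ((F \<circ> L) \<circ> \<Psi>)"
      using \<Psi>(1) linear_continuous_on
      by (intro continuous_on_compose continuous_on_subset[OF L(3)])
        (auto simp: linear_conv_bounded_linear simp del: o_apply)
    fix w assume "w \<in> V"
    then obtain x where "w = L x"
      using L(2) by (auto simp: bij_betw_def)
    then show "F w = ((F \<circ> L) \<circ> \<Psi>) (fst w d, snd w d)"
      using fun_cong[OF \<Psi>(2), of x] by (simp add: \<Phi>_def)
  qed
qed

section \<open>Left-invariant extension\<close>

text \<open>\<open>smooth_on\<close> yields continuity of the derivative in \<open>x\<close> only
  for each fixed direction \<open>v\<close>. Expanding \<open>v\<close> in the finite basis turns it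
  into a finite sum of jointly continuous terms.\<close>

lemma continuous_on_frechet_derivative:
  fixes f :: "'v::euclidean_space \<Rightarrow> 'w::real_normed_vector"
  assumes f: "smooth_on S f"
  shows "continuous_on (S \<times> UNIV) (\<lambda>(x, v). frechet_derivative f (at x) v)"
proof -
  have "frechet_derivative f (at x) v = (\<Sum>b\<in>Basis. (v \<bullet> b) *\<^sub>R frechet_derivative f (at x) b)"
    if "x \<in> S" for x v
  proof -
    have lin: "linear (frechet_derivative f (at x))"
      using smooth_on_imp_differentiable[OF f that] by (rule linear_frechet_derivative)
    have "frechet_derivative f (at x) v = frechet_derivative f (at x) (\<Sum>b\<in>Basis. (v \<bullet> b) *\<^sub>R b)"
      by (simp add: euclidean_representation)
    also have "\<dots> = (\<Sum>b\<in>Basis. (v \<bullet> b) *\<^sub>R frechet_derivative f (at x) b)"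
      by (simp add: linear_sum[OF lin] linear_scale[OF lin])
    finally show ?thesis .
  qed
  moreover have "continuous_on (S \<times> UNIV)
      (\<lambda>y. \<Sum>b\<in>Basis. (snd y \<bullet> b) *\<^sub>R frechet_derivative f (at (fst y)) b)"
    by (intro continuous_intros continuous_on_compose2[OF smooth_on_imp_continuous_on_derivative[OF f]])
      auto
  ultimately show ?thesis
    by (subst continuous_on_cong[OF refl]) auto
qed

text \<open>Restricted to the bundle because metrics are extensional functions; the fixed default
  value elsewhere lets extension and restriction be inverse to each other as functions.\<close>

definition left_invariant_extension ::
    "'a topology \<Rightarrow> ('a, 'e::euclidean_space) chart set \<Rightarrow> ('a, complex ^ 'n) chart set \<Rightarrow>
     ('a, 'm) monoid_scheme \<Rightarrow> (('a, 'e) tangent \<times> ('a, 'e) tangent \<Rightarrow> real) \<Rightarrow>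
     'a \<times> ('a, 'e) tangent \<times> ('a, 'e) tangent \<Rightarrow> real" where
  "left_invariant_extension X A Z G F =
     (\<lambda>v\<in>holomorphic_tangent_bundle X A Z.
        F (left_differential A G (inv\<^bsub>G\<^esub> (fst v)) (fst v) (snd v)))"

lemma mem_holomorphic_tangent_bundle:
  "(p, w) \<in> holomorphic_tangent_bundle X A Z \<longleftrightarrow>
     p \<in> topspace X \<and> w \<in> holomorphic_tangent_space A Z p"
  by (simp add: holomorphic_tangent_bundle_def)

text \<open>In coordinates the extension applies \<open>H\<close> to the images of
  \<open>\<xi> c\<close> and \<open>\<eta> c\<close> under a partial derivative of the
  multiplication at the pair of the inverse of \<open>p\<close> and \<open>p\<close>. The chart
  \<open>b\<close> serves to read the inverse, so \<open>p\<close> is confined to points whose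
  inverse lies in \<open>fst b\<close>.\<close>

lemma left_invariant_extension_in_charts:
  fixes X :: "'a topology" and A :: "('a, 'e::euclidean_space) chart set"
    and Z :: "('a, complex ^ 'n) chart set"
  assumes G: "lie_group X A G" and J: "left_invariant_complex_structure A Z G"
    and F: "complex_minkowski_norm TYPE('n) cscale (holomorphic_tangent_space A Z \<one>\<^bsub>G\<^esub>) F"
    and b: "b \<in> A" and c: "c \<in> A"
  obtains Q :: "'e \<times> 'e \<times> 'e \<Rightarrow> real" where
    "continuous_on (snd c ` {p \<in> fst c. inv\<^bsub>G\<^esub> p \<in> fst b} \<times> UNIV \<times> UNIV) Q"
    "\<And>p \<xi> \<eta>. p \<in> fst c \<Longrightarrow> inv\<^bsub>G\<^esub> p \<in> fst b \<Longrightarrow> (p, \<xi>, \<eta>) \<in> holomorphic_tangent_bundle X A Z \<Longrightarrow>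
       left_invariant_extension X A Z G F (p, \<xi>, \<eta>) = Q (snd c p, \<xi> c, \<eta> c)"
proof -
  interpret group G using lie_groupD[OF G] by simp
  note XA = lie_groupD(3)[OF G] and car = lie_groupD(2)[OF G]
  obtain d where d: "d \<in> charts_at A \<one>\<^bsub>G\<^esub>"
    using smooth_manifold_charts_at[OF XA] one_closed unfolding car by blast
  have bA: "is_chart X b" and cA: "is_chart X c"
    using XA b c by (auto simp: smooth_manifold_def topological_manifold_atlas_def)
  have dA: "d \<in> A" "\<one>\<^bsub>G\<^esub> \<in> fst d"
    using d by (auto simp: charts_at_def)
  obtain H where H: "continuous_on UNIV H"
    "\<And>w. w \<in> holomorphic_tangent_space A Z \<one>\<^bsub>G\<^esub> \<Longrightarrow> F w = H (fst w d, snd w d)"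
    using complex_minkowski_norm_in_chart[OF F holomorphic_tangent_space_subset d] by blast
  define O' where "O' = snd c ` {p \<in> fst c. inv\<^bsub>G\<^esub> p \<in> fst b}"
  define S where "S = (\<lambda>(x, y). (snd b x, snd c y)) `
      {(x, y). x \<in> fst b \<and> y \<in> fst c \<and> x \<otimes>\<^bsub>G\<^esub> y \<in> fst d}"
  \<comment> \<open>\<open>K\<close> sends the coordinates of \<open>p\<close> to those of the pair
    of its inverse and \<open>p\<close>. Then \<open>D z\<close> is the differential at
    \<open>p\<close> of the translation back to the unit, read from \<open>c\<close> to
    \<open>d\<close>.\<close>
  define K where "K = (\<lambda>z. ((snd b \<circ> (\<lambda>x. inv\<^bsub>G\<^esub> x) \<circ> chart_inv c) z, z))"
  define D where "D = (\<lambda>z u. frechet_derivative (local_mult G b c d) (at (K z)) (0, u))"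
  have sub: "fst c \<subseteq> carrier G"
    using cA unfolding car by (auto simp: is_chart_def dest: openin_subset)
  have K: "K (snd c p) = (snd b (inv\<^bsub>G\<^esub> p), snd c p)" if "p \<in> fst c" for p
    using chart_inv_image[OF cA that] by (simp add: K_def)
  have KS: "K ` O' \<subseteq> S"
  proof
    fix y assume "y \<in> K ` O'"
    then obtain p where p: "p \<in> fst c" "inv\<^bsub>G\<^esub> p \<in> fst b" "y = K (snd c p)"
      by (auto simp: O'_def)
    \<comment> \<open>The product is the unit, and \<open>d\<close> was chosen around it; so
      \<open>K\<close> stays in the set on which the local multiplication is smooth.\<close>
    moreover have "inv\<^bsub>G\<^esub> p \<otimes>\<^bsub>G\<^esub> p \<in> fst d"
      using p(1) sub dA(2) by (simp add: subset_iff)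
    ultimately show "y \<in> S"
      unfolding S_def using K by (intro image_eqI[of _ _ "(inv\<^bsub>G\<^esub> p, p)"]) auto
  qed
  have "smooth_map X A X A (\<lambda>x. inv\<^bsub>G\<^esub> x)"
    using G by (simp add: lie_group_def)
  then have "continuous_on O' (snd b \<circ> (\<lambda>x. inv\<^bsub>G\<^esub> x) \<circ> chart_inv c)"
    using b c unfolding smooth_map_def O'_def by (intro smooth_on_imp_continuous_on) blast
  then have contK: "continuous_on O' K"
    unfolding K_def by (intro continuous_on_Pair continuous_on_id)
  have "continuous_on (S \<times> UNIV) (\<lambda>(x, v). frechet_derivative (local_mult G b c d) (at x) v)"
    unfolding S_def by (intro continuous_on_frechet_derivative smooth_on_local_mult[OF G b c dA(1)])
  then have contD: "continuous_on (O' \<times> UNIV) (\<lambda>y. D (fst y) (snd y))"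
  proof -
    have "continuous_on (O' \<times> UNIV) (\<lambda>y. (K (fst y), (0::'e, snd y :: 'e)))"
      by (intro continuous_intros continuous_on_compose2[OF contK]) auto
    from continuous_on_compose2[OF \<open>continuous_on (S \<times> UNIV) _\<close> this] KS
    show ?thesis
      by (auto simp: D_def image_subset_iff)
  qed
  define Q where "Q = (\<lambda>(z, u, v). H (D z u, D z v))"
  show thesis
  proof
    \<comment> \<open>\<open>h\<close> will be each of the two projections, which pick the real and
      the imaginary part of the vector.\<close>
    have "continuous_on (O' \<times> UNIV \<times> UNIV) (\<lambda>y. D (fst y) (h (snd y)))"
      if "continuous_on UNIV h" for h :: "'e \<times> 'e \<Rightarrow> 'e"
    proof -
      have "continuous_on (O' \<times> UNIV \<times> UNIV) (\<lambda>y. (fst y, h (snd y)))"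
        by (intro continuous_intros continuous_on_compose2[OF that]) auto
      moreover have "(\<lambda>y. (fst y, h (snd y))) ` (O' \<times> UNIV \<times> UNIV) \<subseteq> O' \<times> UNIV"
        by auto
      ultimately show ?thesis
        using continuous_on_compose2[OF contD] by fastforce
    qed
    from this[OF continuous_on_fst[OF continuous_on_id]] this[OF continuous_on_snd[OF continuous_on_id]]
    have "continuous_on (O' \<times> UNIV \<times> UNIV) (\<lambda>y. (D (fst y) (fst (snd y)), D (fst y) (snd (snd y))))"
      by (rule continuous_on_Pair)
    from continuous_on_compose2[OF H(1) this] have "continuous_on (O' \<times> UNIV \<times> UNIV) Q"
      by (simp add: Q_def case_prod_unfold)
    then show "continuous_on (snd c ` {p \<in> fst c. inv\<^bsub>G\<^esub> p \<in> fst b} \<times> UNIV \<times> UNIV) Q"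
      by (simp add: O'_def)
  next
    fix p \<xi> \<eta>
    assume p: "p \<in> fst c" "inv\<^bsub>G\<^esub> p \<in> fst b" and v: "(p, \<xi>, \<eta>) \<in> holomorphic_tangent_bundle X A Z"
    have pG: "p \<in> carrier G" and w: "(\<xi>, \<eta>) \<in> holomorphic_tangent_space A Z p"
      using v by (auto simp: mem_holomorphic_tangent_bundle car)
    have "(\<xi>, \<eta>) \<in> tangent_space A p \<times> tangent_space A p"
      by (rule subsetD[OF holomorphic_tangent_space_subset w])
    then have t: "\<xi> \<in> tangent_space A p" "\<eta> \<in> tangent_space A p"
      by auto
    have charts: "b \<in> charts_at A (inv\<^bsub>G\<^esub> p)" "c \<in> charts_at A p" "d \<in> charts_at A (inv\<^bsub>G\<^esub> p \<otimes>\<^bsub>G\<^esub> p)"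
      using p b c d pG by (auto simp: charts_at_def)
    have D: "differential A A (left_translation G (inv\<^bsub>G\<^esub> p)) p \<zeta> d = D (snd c p) (\<zeta> c)"
      if "\<zeta> \<in> tangent_space A p" for \<zeta>
      unfolding D_def K[OF p(1)]
      by (rule differential_left_translation[OF G inv_closed[OF pG] pG that charts])
    show "left_invariant_extension X A Z G F (p, \<xi>, \<eta>) = Q (snd c p, \<xi> c, \<eta> c)"
      using H(2)[OF left_differential_inv_holomorphic[OF G J pG w]] v D[OF t(1)] D[OF t(2)]
      by (simp add: left_invariant_extension_def Q_def complexified_map_def)
  qed
qed

text \<open>Continuity is checked locally: near each vector the extension is a continuous function
  \<open>Q\<close> of bundle coordinates, so the preimage of an open set contains a neighbourhood
  cut out by a bundle chart.\<close>

lemma continuous_map_left_invariant_extension: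
  fixes Z :: "('a, complex ^ 'n) chart set"
  assumes G: "lie_group X A G" and J: "left_invariant_complex_structure A Z G"
    and F: "complex_minkowski_norm TYPE('n) cscale (holomorphic_tangent_space A Z \<one>\<^bsub>G\<^esub>) F"
  shows "continuous_map (holomorphic_tangent_topology X A Z) euclideanreal
           (left_invariant_extension X A Z G F)"
proof -
  interpret group G using lie_groupD[OF G] by simp
  note XA = lie_groupD(3)[OF G] and car = lie_groupD(2)[OF G]
  let ?f = "left_invariant_extension X A Z G F" and ?X = "holomorphic_tangent_topology X A Z"
  have sub: "topspace ?X \<subseteq> holomorphic_tangent_bundle X A Z"
    by (auto simp: holomorphic_tangent_topology_def)
  have "\<exists>N. openin ?X N \<and> v \<in> N \<and> N \<subseteq> {v \<in> topspace ?X. ?f v \<in> U}"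
    if U: "open U" and v: "v \<in> {v \<in> topspace ?X. ?f v \<in> U}" for U v
  proof -
    obtain p \<xi> \<eta> where v_eq: "v = (p, \<xi>, \<eta>)"
      by (cases v)
    have vb: "(p, \<xi>, \<eta>) \<in> holomorphic_tangent_bundle X A Z"
      using v v_eq sub by auto
    then have pX: "p \<in> topspace X" and w: "(\<xi>, \<eta>) \<in> holomorphic_tangent_space A Z p"
      by (auto simp: mem_holomorphic_tangent_bundle)
    then have "inv\<^bsub>G\<^esub> p \<in> topspace X"
      using car inv_closed by auto
    then obtain b c where "b \<in> charts_at A (inv\<^bsub>G\<^esub> p)" "c \<in> charts_at A p"
      using smooth_manifold_charts_at[OF XA] pX by (metis ex_in_conv)
    then have bc: "b \<in> A" "c \<in> A" "inv\<^bsub>G\<^esub> p \<in> fst b" "p \<in> fst c"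
      by (auto simp: charts_at_def)
    obtain Q where Q: "continuous_on (snd c ` {p \<in> fst c. inv\<^bsub>G\<^esub> p \<in> fst b} \<times> UNIV \<times> UNIV) Q"
      "\<And>p \<xi> \<eta>. p \<in> fst c \<Longrightarrow> inv\<^bsub>G\<^esub> p \<in> fst b \<Longrightarrow> (p, \<xi>, \<eta>) \<in> holomorphic_tangent_bundle X A Z \<Longrightarrow>
         ?f (p, \<xi>, \<eta>) = Q (snd c p, \<xi> c, \<eta> c)"
      using left_invariant_extension_in_charts[OF G J F bc(1,2)] by blast
    define O' where "O' = snd c ` {p \<in> fst c. inv\<^bsub>G\<^esub> p \<in> fst b}"
    have ch: "is_chart X b" "is_chart X c"
      using XA bc by (auto simp: smooth_manifold_def topological_manifold_atlas_def)
    have "open O'"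
      unfolding O'_def using G
      by (intro open_chart_image[OF ch(2)] openin_continuous_preimage_chart[OF ch(2,1)])
        (auto simp: lie_group_def smooth_map_def)
    \<comment> \<open>The factor \<open>O'\<close> keeps the inverses of base points in
      \<open>fst b\<close>, where the formula through \<open>Q\<close> is valid.\<close>
    define W where "W = (O' \<times> UNIV \<times> UNIV) \<inter> Q -` U"
    have W: "open W"
      unfolding W_def using Q(1) \<open>open O'\<close> U
      by (intro continuous_open_preimage) (auto simp: O'_def intro!: open_Times)
    define N where "N = {(p, \<xi>, \<eta>) \<in> complexified_tangent_bundle X A. p \<in> fst c \<and> (snd c p, \<xi> c, \<eta> c) \<in> W}"
    have "openin (complexified_tangent_topology X A) N"
      unfolding complexified_tangent_topology_def N_def
      using bc(2) W by (intro topology_generated_by_Basis) blast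
    then have op: "openin ?X (N \<inter> holomorphic_tangent_bundle X A Z)"
      unfolding holomorphic_tangent_topology_def by (rule openin_subtopology_Int)
    have "v \<in> N"
    proof -
      have "(p, \<xi>, \<eta>) \<in> complexified_tangent_bundle X A"
        using pX w holomorphic_tangent_space_subset[of A Z p]
        by (auto simp: complexified_tangent_bundle_def complexification_def)
      moreover have "(snd c p, \<xi> c, \<eta> c) \<in> W"
        using v Q(2)[OF bc(4,3) vb] bc by (auto simp: W_def O'_def v_eq)
      ultimately show ?thesis
        using bc(4) by (simp add: N_def v_eq)
    qed
    moreover have "?f y \<in> U" if y: "y \<in> N \<inter> holomorphic_tangent_bundle X A Z" for y
    proof -
      obtain q \<alpha> \<beta> where y_eq: "y = (q, \<alpha>, \<beta>)"
        by (cases y)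
      have q: "q \<in> fst c" "(snd c q, \<alpha> c, \<beta> c) \<in> W"
        and yb: "(q, \<alpha>, \<beta>) \<in> holomorphic_tangent_bundle X A Z"
        using y by (auto simp: N_def y_eq)
      \<comment> \<open>Membership in \<open>W\<close> gives only some \<open>q'\<close> with the
        same coordinates as \<open>q\<close>; injectivity of the chart identifies the two.\<close>
      obtain q' where "q' \<in> fst c" "inv\<^bsub>G\<^esub> q' \<in> fst b" "snd c q' = snd c q"
        using q(2) by (auto simp: W_def O'_def)
      then have "inv\<^bsub>G\<^esub> q \<in> fst b"
        using chart_inj_on[OF ch(2)] q(1) by (metis inj_onD)
      then show ?thesis
        using Q(2)[OF q(1) _ yb] q(2) by (simp add: W_def y_eq)
    qed
    ultimately show ?thesis
      using op vb openin_subset[OF op] by (intro exI[of _ "N \<inter> holomorphic_tangent_bundle X A Z"]) (auto simp: v_eq)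
  qed
  then show ?thesis
    unfolding continuous_map_def by (subst openin_subopen) auto
qed

text \<open>On the fibre over \<open>p\<close> the extension is \<open>F\<close> transported along
  the left differential of \<open>p\<close> at the unit, a linear bijection onto that fibre whose
  inverse appears in the definition of the extension.\<close>

lemma complex_finsler_metric_left_invariant_extension:
  fixes Z :: "('a, complex ^ 'n) chart set"
  assumes G: "lie_group X A G" and J: "left_invariant_complex_structure A Z G"
    and F: "complex_minkowski_norm TYPE('n) cscale (holomorphic_tangent_space A Z \<one>\<^bsub>G\<^esub>) F"
  shows "complex_finsler_metric X A Z (left_invariant_extension X A Z G F)"
  unfolding complex_finsler_metric_def
proof (intro conjI ballI continuous_map_left_invariant_extension[OF assms])
  interpret group G using lie_groupD[OF G] by simp
  note car = lie_groupD(2)[OF G]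
  let ?f = "left_invariant_extension X A Z G F"
  have "F (left_differential A G (inv\<^bsub>G\<^esub> p) p w) \<ge> 0"
    if "(p, w) \<in> holomorphic_tangent_bundle X A Z" for p w
    using that F left_differential_inv_holomorphic[OF G J, of p w]
    by (auto simp: complex_minkowski_norm_def mem_holomorphic_tangent_bundle car)
  then show nonneg: "?f \<in> holomorphic_tangent_bundle X A Z \<rightarrow>\<^sub>E {0..}"
    unfolding left_invariant_extension_def by auto
  fix p assume "p \<in> topspace X"
  then have p: "p \<in> carrier G"
    by (simp add: car)
  show "complex_minkowski_norm TYPE('n) cscale (holomorphic_tangent_space A Z p)
      (\<lambda>w\<in>holomorphic_tangent_space A Z p. ?f (p, w))"
  proof (rule complex_minkowski_norm_transport[OF F bij_betw_left_differential[OF G J p]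
        left_differential_add[OF G p one_closed] left_differential_cscale[OF G p one_closed]])
    fix v assume v: "v \<in> holomorphic_tangent_space A Z \<one>\<^bsub>G\<^esub>"
    have "v \<in> tangent_space A \<one>\<^bsub>G\<^esub> \<times> tangent_space A \<one>\<^bsub>G\<^esub>"
      by (rule subsetD[OF holomorphic_tangent_space_subset v])
    moreover have "left_differential A G p \<one>\<^bsub>G\<^esub> v \<in> holomorphic_tangent_space A Z p"
      using left_differential_holomorphic[OF G J p one_closed v] p by simp
    ultimately show "(\<lambda>w\<in>holomorphic_tangent_space A Z p. ?f (p, w)) (left_differential A G p \<one>\<^bsub>G\<^esub> v) = F v"
      using \<open>p \<in> topspace X\<close> left_differential_inverse(1)[OF G p]
      by (simp add: left_invariant_extension_def mem_holomorphic_tangent_bundle)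
  next
    show "(\<lambda>w\<in>holomorphic_tangent_space A Z p. ?f (p, w)) \<in> holomorphic_tangent_space A Z p \<rightarrow>\<^sub>E {0..}"
      using PiE_mem[OF nonneg] \<open>p \<in> topspace X\<close>
      by (intro restrict_PiE_iff[THEN iffD2]) (simp add: mem_holomorphic_tangent_bundle)
  qed
qed

section \<open>Invariance and uniqueness of the extension\<close>

lemma left_invariant_metric_left_invariant_extension:
  assumes G: "lie_group X A G" and J: "left_invariant_complex_structure A Z G"
  shows "left_invariant_metric X A Z G (left_invariant_extension X A Z G F)"
  unfolding left_invariant_metric_def
proof (intro ballI)
  interpret group G using lie_groupD[OF G] by simp
  note car = lie_groupD(2)[OF G]
  fix g v assume g: "g \<in> carrier G" and "v \<in> holomorphic_tangent_bundle X A Z"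
  then obtain p w where v: "v = (p, w)" "p \<in> carrier G" "w \<in> holomorphic_tangent_space A Z p"
    by (cases v) (auto simp: mem_holomorphic_tangent_bundle car)
  have "w \<in> tangent_space A p \<times> tangent_space A p"
    by (rule subsetD[OF holomorphic_tangent_space_subset v(3)])
  \<comment> \<open>Translating by \<open>g\<close> and then back to the unit is the same as
    translating straight back from \<open>p\<close>.\<close>
  moreover have "inv\<^bsub>G\<^esub> (g \<otimes>\<^bsub>G\<^esub> p) \<otimes>\<^bsub>G\<^esub> g = inv\<^bsub>G\<^esub> p"
    using g v by (simp add: inv_mult_group m_assoc)
  ultimately have "left_differential A G (inv\<^bsub>G\<^esub> (g \<otimes>\<^bsub>G\<^esub> p)) (g \<otimes>\<^bsub>G\<^esub> p) (left_differential A G g p w) =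
      left_differential A G (inv\<^bsub>G\<^esub> p) p w"
    using left_differential_compose[OF G g _ v(2), of "inv\<^bsub>G\<^esub> (g \<otimes>\<^bsub>G\<^esub> p)" w] g v by simp
  moreover have "g \<otimes>\<^bsub>G\<^esub> p \<in> topspace X"
    using g v m_closed unfolding car by blast
  ultimately show "left_invariant_extension X A Z G F (left_pushforward A G g v) =
      left_invariant_extension X A Z G F v"
    using v left_differential_holomorphic[OF G J g v(2,3)] car
    by (simp add: left_pushforward_def left_invariant_extension_def mem_holomorphic_tangent_bundle)
qed

lemma left_invariant_extension_restrict:
  assumes G: "lie_group X A G" and J: "left_invariant_complex_structure A Z G"
    and f: "left_invariant_metric X A Z G f" "f \<in> extensional (holomorphic_tangent_bundle X A Z)"
  shows "left_invariant_extension X A Z G (\<lambda>w\<in>holomorphic_tangent_space A Z \<one>\<^bsub>G\<^esub>. f (\<one>\<^bsub>G\<^esub>, w)) = f"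
proof
  interpret group G using lie_groupD[OF G] by simp
  note car = lie_groupD(2)[OF G]
  fix v :: "'a \<times> ('a, 'b) tangent \<times> ('a, 'b) tangent"
  obtain p w where v: "v = (p, w)"
    by (cases v)
  show "left_invariant_extension X A Z G (\<lambda>w\<in>holomorphic_tangent_space A Z \<one>\<^bsub>G\<^esub>. f (\<one>\<^bsub>G\<^esub>, w)) v = f v"
  proof (cases "v \<in> holomorphic_tangent_bundle X A Z")
    case True
    then have p: "p \<in> carrier G" and w: "w \<in> holomorphic_tangent_space A Z p"
      by (simp_all add: v mem_holomorphic_tangent_bundle car)
    \<comment> \<open>Invariance under the inverse of \<open>p\<close> moves \<open>v\<close> to the
      fibre over the unit, where the restriction knows the value.\<close>
    have "f (left_pushforward A G (inv\<^bsub>G\<^esub> p) v) = f v"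
      using f(1) True inv_closed[OF p] unfolding left_invariant_metric_def by blast
    then show ?thesis
      using True p left_differential_inv_holomorphic[OF G J p w]
      by (simp add: v left_invariant_extension_def left_pushforward_def)
  next
    case False
    then show ?thesis
      using extensional_arb[OF f(2)] by (simp add: left_invariant_extension_def)
  qed
qed

text \<open>Over the unit the extension applies the left differential of the inverse of the unit,
  which is the identity.\<close>

lemma restrict_left_invariant_extension:
  assumes G: "lie_group X A G" and F: "F \<in> extensional (holomorphic_tangent_space A Z \<one>\<^bsub>G\<^esub>)"
  shows "(\<lambda>w\<in>holomorphic_tangent_space A Z \<one>\<^bsub>G\<^esub>. left_invariant_extension X A Z G F (\<one>\<^bsub>G\<^esub>, w)) = F"
proof
  interpret group G using lie_groupD[OF G] by simp
  fix w
  have "\<one>\<^bsub>G\<^esub> \<in> topspace X"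
    using one_closed unfolding lie_groupD(2)[OF G] .
  moreover have "left_differential A G \<one>\<^bsub>G\<^esub> \<one>\<^bsub>G\<^esub> w = w" if "w \<in> holomorphic_tangent_space A Z \<one>\<^bsub>G\<^esub>"
    by (rule left_differential_one[OF G one_closed subsetD[OF holomorphic_tangent_space_subset that]])
  ultimately show "(\<lambda>w\<in>holomorphic_tangent_space A Z \<one>\<^bsub>G\<^esub>. left_invariant_extension X A Z G F (\<one>\<^bsub>G\<^esub>, w)) w = F w"
    using extensional_arb[OF F]
    by (simp add: left_invariant_extension_def mem_holomorphic_tangent_bundle)
qed

theorem proposition1p1:
  fixes X :: "'a topology"
    and A :: "('a, 'e::euclidean_space) chart set"
    and Z :: "('a, complex ^ 'n) chart set"
    and G :: "('a, 'm) monoid_scheme"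
  assumes "lie_group X A G"
    and "connected_space X"
    and "complex_manifold X Z"
    and "compatible_atlases X A Z"
    and "left_invariant_complex_structure A Z G"
    and "is_direct_sum (complexification (lie_algebra A G)) (lie_algebra_10 A Z G) (lie_algebra_01 A Z G)"
  shows "bij_betw (\<lambda>F'. \<lambda>v\<in>lie_algebra_10 A Z G. F' (\<one>\<^bsub>G\<^esub>, v))
           {F'. complex_finsler_metric X A Z F' \<and> left_invariant_metric X A Z G F'}
           {F. complex_minkowski_norm TYPE('n) cscale (lie_algebra_10 A Z G) F}"
proof -
  note G = assms(1) and J = assms(5)
  \<comment> \<open>By the definitions, the (1,0) part of the Lie algebra is the fibre of the
    holomorphic tangent bundle over the unit.\<close>
  have 10: "lie_algebra_10 A Z G = holomorphic_tangent_space A Z \<one>\<^bsub>G\<^esub>"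
    by (simp add: lie_algebra_10_def lie_algebra_def holomorphic_tangent_space_def)
  have one: "\<one>\<^bsub>G\<^esub> \<in> topspace X"
    using monoid.one_closed[OF group.is_monoid[OF lie_groupD(1)[OF G]]] unfolding lie_groupD(2)[OF G] .
  show ?thesis
    unfolding 10
  \<comment> \<open>The goals are, in order: extension undoes restriction, restriction undoes
    extension, restriction yields a norm, extension yields an invariant metric.\<close>
  proof (rule bij_betw_byWitness[where f' = "left_invariant_extension X A Z G"], goal_cases)
    case 1
    then show ?case
      using left_invariant_extension_restrict[OF G J] by (auto simp: complex_finsler_metric_def PiE_def)
  next
    case 2
    then show ?case
      using restrict_left_invariant_extension[OF G] by (auto simp: complex_minkowski_norm_def PiE_def)
  next
    case 3
    then show ?case
      using one by (auto simp: complex_finsler_metric_def)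
  next
    case 4
    then show ?case
      using complex_finsler_metric_left_invariant_extension[OF G J]
        left_invariant_metric_left_invariant_extension[OF G J] by auto
  qed
qed

end
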